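(* For any smooth immersed parametrized hypersurface $\mathbf{x}=\mathbf{x}(u,v,w)$ in $\mathbb{E}^4$ with fundamental forms $I,II,III,IV$ and $i$-th curvatures $\mathfrak{C}_0,\dots,\mathfrak{C}_3$, $$\mathfrak{C}_0\,IV-3\mathfrak{C}_1\,III+3\mathfrak{C}_2\,II-\mathfrak{C}_3\,I=0.$$
   Context: $\mathbb{E}^4$ is $\mathbb{R}^4$ with its standard inner product. $I$ is the matrix of the first fundamental form in the coordinates $(u,v,w)$ (the Gram matrix of $\mathbf{x}_u,\mathbf{x}_v,\mathbf{x}_w$), $II$ is the matrix of the second fundamental form (inner products of second partial derivatives of $\mathbf{x}$ with the unit normal $\mathbf{G}$), and $\mathbf{S}=I^{-1}\cdot II$ is the shape operator matrix. The $k$-th fundamental form is defined by $(X,Y)\mapsto\langle\mathbf{S}^{k-1}(X),Y\rangle$ for tangent vectors $X,Y$; in matrix form, $II=I\cdot\mathbf{S}$, $III=II\cdot\mathbf{S}$, $IV=III\cdot\mathbf{S}$. The $i$-th curvatures $\mathfrak{C}_i$ ($i=0,\dots,3$) are defined by $\binom{3}{i}\mathfrak{C}_i=s_i$, where $s_i$ is the $i$-th elementary symmetric function of the eigenvalues (principal curvatures) of $\mathbf{S}$, with $s_0=1$. *)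

theory Defs
  imports "HOL-Analysis.Analysis" "HOL-Computational_Algebra.Polynomial"
begin

primrec Ck_on :: "nat \<Rightarrow> ('a::real_normed_vector \<Rightarrow> 'b::real_normed_vector) \<Rightarrow> 'a set \<Rightarrow> bool" where
  "Ck_on 0 f U \<longleftrightarrow> continuous_on U f"
| "Ck_on (Suc k) f U \<longleftrightarrow> (\<forall>p\<in>U. f differentiable (at p)) \<and>
     (\<forall>v. Ck_on k (\<lambda>p. frechet_derivative f (at p) v) U)"

definition smooth_on :: "('a::real_normed_vector \<Rightarrow> 'b::real_normed_vector) \<Rightarrow> 'a set \<Rightarrow> bool" where
  "smooth_on f U \<longleftrightarrow> (\<forall>k. Ck_on k f U)"

definition immersion_on :: "(real^3 \<Rightarrow> real^4) \<Rightarrow> (real^3) set \<Rightarrow> bool" where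
  "immersion_on x U \<longleftrightarrow> (\<forall>p\<in>U. inj (frechet_derivative x (at p)))"

text \<open>The coordinates \<open>u\<close>, \<open>v\<close>, \<open>w\<close> are the components of a point of \<open>real^3\<close>.\<close>

definition partial :: "3 \<Rightarrow> (real^3 \<Rightarrow> real^4) \<Rightarrow> real^3 \<Rightarrow> real^4" where
  "partial i f p = frechet_derivative f (at p) (axis i 1)"

text \<open>A hypersurface has two unit normals at each point; either choice is allowed.\<close>

definition unit_normal_on :: "(real^3 \<Rightarrow> real^4) \<Rightarrow> (real^3 \<Rightarrow> real^4) \<Rightarrow> (real^3) set \<Rightarrow> bool" where
  "unit_normal_on x G U \<longleftrightarrow> (\<forall>p\<in>U. norm (G p) = 1 \<and> (\<forall>i. G p \<bullet> partial i x p = 0))"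

definition form_I :: "(real^3 \<Rightarrow> real^4) \<Rightarrow> real^3 \<Rightarrow> real^3^3" where
  "form_I x p = (\<chi> i j. partial i x p \<bullet> partial j x p)"

definition form_II :: "(real^3 \<Rightarrow> real^4) \<Rightarrow> (real^3 \<Rightarrow> real^4) \<Rightarrow> real^3 \<Rightarrow> real^3^3" where
  "form_II x G p = (\<chi> i j. partial j (partial i x) p \<bullet> G p)"

definition shape_matrix :: "(real^3 \<Rightarrow> real^4) \<Rightarrow> (real^3 \<Rightarrow> real^4) \<Rightarrow> real^3 \<Rightarrow> real^3^3" where
  "shape_matrix x G p = matrix_inv (form_I x p) ** form_II x G p"

definition form_III :: "(real^3 \<Rightarrow> real^4) \<Rightarrow> (real^3 \<Rightarrow> real^4) \<Rightarrow> real^3 \<Rightarrow> real^3^3" where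
  "form_III x G p = form_II x G p ** shape_matrix x G p"

definition form_IV :: "(real^3 \<Rightarrow> real^4) \<Rightarrow> (real^3 \<Rightarrow> real^4) \<Rightarrow> real^3 \<Rightarrow> real^3^3" where
  "form_IV x G p = form_III x G p ** shape_matrix x G p"

definition charpoly :: "'a::comm_ring_1^'n^'n \<Rightarrow> 'a poly" where
  "charpoly A = det (\<chi> i j. (if i = j then [:0, 1:] else 0) - [:A $ i $ j:])"

text \<open>The real eigenvalues of the shape operator, repeated according to algebraic multiplicity.\<close>

definition principal_curvatures :: "(real^3 \<Rightarrow> real^4) \<Rightarrow> (real^3 \<Rightarrow> real^4) \<Rightarrow> real^3 \<Rightarrow> real list" where
  "principal_curvatures x G p = sorted_list_of_multiset (proots (charpoly (shape_matrix x G p)))"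

definition elem_sym :: "nat \<Rightarrow> 'a::comm_semiring_1 list \<Rightarrow> 'a" where
  "elem_sym k xs = (\<Sum>J | J \<subseteq> {..<length xs} \<and> card J = k. \<Prod>j\<in>J. xs ! j)"

definition curvature :: "(real^3 \<Rightarrow> real^4) \<Rightarrow> (real^3 \<Rightarrow> real^4) \<Rightarrow> nat \<Rightarrow> real^3 \<Rightarrow> real" where
  "curvature x G i p = elem_sym i (principal_curvatures x G p) / real (3 choose i)"

text \<open>
  The matrices above represent the fundamental forms \<open>(X, Y) \<mapsto> \<langle>S\<^sup>k\<^sup>-\<^sup>1 X, Y\<rangle>\<close> on the tangent
  space, which is the range of the differential. The shape operator is its matrix transported
  to the tangent space along the differential.
\<close>

definition shape_operator :: "(real^3 \<Rightarrow> real^4) \<Rightarrow> (real^3 \<Rightarrow> real^4) \<Rightarrow> real^3 \<Rightarrow> real^4 \<Rightarrow> real^4" where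
  "shape_operator x G p X =
     (let D = frechet_derivative x (at p) in D (shape_matrix x G p *v inv D X))"

definition fundamental_form ::
  "(real^3 \<Rightarrow> real^4) \<Rightarrow> (real^3 \<Rightarrow> real^4) \<Rightarrow> nat \<Rightarrow> real^3 \<Rightarrow> real^4 \<Rightarrow> real^4 \<Rightarrow> real" where
  "fundamental_form x G k p X Y = (shape_operator x G p ^^ (k - 1)) X \<bullet> Y"

lemma inner_differential:
  assumes "x differentiable (at p)"
  shows "frechet_derivative x (at p) a \<bullet> frechet_derivative x (at p) b = b \<bullet> (form_I x p *v a)"
proof -
  interpret D: linear "frechet_derivative x (at p)"
    using assms by (rule linear_frechet_derivative)
  have e: "frechet_derivative x (at p) c = (\<Sum>i\<in>UNIV. c $ i *\<^sub>R partial i x p)" for c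
  proof -
    have "c = (\<Sum>i\<in>UNIV. c $ i *\<^sub>R axis i 1)"
      by (simp add: vec_eq_iff axis_def if_distrib cong: if_cong)
    then have "frechet_derivative x (at p) c
        = frechet_derivative x (at p) (\<Sum>i\<in>UNIV. c $ i *\<^sub>R axis i 1)" by simp
    also have "\<dots> = (\<Sum>i\<in>UNIV. c $ i *\<^sub>R partial i x p)"
      by (simp add: D.sum D.scaleR partial_def)
    finally show ?thesis .
  qed
  have "(\<Sum>i\<in>UNIV. a $ i *\<^sub>R partial i x p) \<bullet> (\<Sum>j\<in>UNIV. b $ j *\<^sub>R partial j x p)
      = (\<Sum>j\<in>UNIV. \<Sum>i\<in>UNIV. a $ i * (b $ j * (partial i x p \<bullet> partial j x p)))"
    by (simp add: inner_sum_left inner_sum_right sum_distrib_left mult_ac)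
  also have "\<dots> = b \<bullet> (form_I x p *v a)"
    by (simp add: form_I_def inner_vec_def matrix_vector_mult_def sum_distrib_left mult_ac
        inner_commute)
  finally show ?thesis by (simp add: e)
qed

lemma invertible_form_I:
  assumes d: "x differentiable (at p)" and i: "inj (frechet_derivative x (at p))"
  shows "invertible (form_I x p)"
proof -
  interpret D: linear "frechet_derivative x (at p)"
    using d by (rule linear_frechet_derivative)
  have "a = 0" if "form_I x p *v a = 0" for a
  proof -
    have "frechet_derivative x (at p) a \<bullet> frechet_derivative x (at p) a = 0"
      by (simp add: inner_differential[OF d] that)
    then have "frechet_derivative x (at p) a = frechet_derivative x (at p) 0"
      by (simp add: D.zero)
    with i show ?thesis by (rule injD)
  qed
  then show ?thesis
    using invertible_left_inverse matrix_left_invertible_ker by blast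
qed

lemma fundamental_form_matrices:
  assumes d: "x differentiable (at p)" and i: "inj (frechet_derivative x (at p))"
    and X: "X = frechet_derivative x (at p) a" and Y: "Y = frechet_derivative x (at p) b"
  shows "fundamental_form x G 1 p X Y = b \<bullet> (form_I x p *v a)"
    and "fundamental_form x G 2 p X Y = b \<bullet> (form_II x G p *v a)"
    and "fundamental_form x G 3 p X Y = b \<bullet> (form_III x G p *v a)"
    and "fundamental_form x G 4 p X Y = b \<bullet> (form_IV x G p *v a)"
proof -
  have s: "shape_operator x G p (frechet_derivative x (at p) c)
      = frechet_derivative x (at p) (shape_matrix x G p *v c)" for c
    using i by (simp add: shape_operator_def Let_def inv_f_f)
  have "form_I x p ** matrix_inv (form_I x p) = mat 1"
    using someI_ex[OF invertible_form_I[OF d i, unfolded invertible_def]]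
    by (simp add: matrix_inv_def)
  then have m: "form_I x p ** shape_matrix x G p = form_II x G p"
    by (simp add: shape_matrix_def matrix_mul_assoc)
  have mv: "form_I x p *v (shape_matrix x G p *v c) = form_II x G p *v c" for c
    by (simp add: matrix_vector_mul_assoc m)
  show "fundamental_form x G 1 p X Y = b \<bullet> (form_I x p *v a)"
    and "fundamental_form x G 2 p X Y = b \<bullet> (form_II x G p *v a)"
    and "fundamental_form x G 3 p X Y = b \<bullet> (form_III x G p *v a)"
    and "fundamental_form x G 4 p X Y = b \<bullet> (form_IV x G p *v a)"
    by (simp_all add: fundamental_form_def X Y s inner_differential[OF d] numeral_eq_Suc mv
        form_III_def form_IV_def flip: matrix_vector_mul_assoc)
qed

end

theory Submission
  imports Defs
begin

text \<open>
  The identity is the Cayley--Hamilton theorem for \<open>S\<close>, multiplied by \<open>I\<close> from the left. The point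
  is that the coefficients of the characteristic polynomial are the elementary symmetric functions
  of its real roots only if it splits over the reals. It does, because \<open>I S = II\<close> is symmetric
  (both mixed second derivatives are limits of the same second difference quotient), so \<open>S\<close> is
  self-adjoint for the inner product given by \<open>I\<close>.
\<close>

section \<open>Characteristic polynomial and symmetric functions in size three\<close>

text \<open>The linear coefficient of the characteristic polynomial, hence the second elementary
  symmetric function of the eigenvalues once it splits.\<close>

definition principal_minors :: "'a::comm_ring_1^3^3 \<Rightarrow> 'a" where
  "principal_minors A = A$1$1 * A$2$2 - A$1$2 * A$2$1 + A$1$1 * A$3$3 - A$1$3 * A$3$1
    + A$2$2 * A$3$3 - A$2$3 * A$3$2"

lemma charpoly_3:
  fixes A :: "'a::comm_ring_1^3^3"
  shows "charpoly A = [:- det A, principal_minors A, - trace A, 1:]"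
  by (simp add: charpoly_def det_3 trace_def sum_3 principal_minors_def algebra_simps)

lemma Cayley_Hamilton_3:
  fixes A :: "real^3^3"
  shows "A ** A ** A - trace A *\<^sub>R (A ** A) + principal_minors A *\<^sub>R A - det A *\<^sub>R mat 1 = 0"
  by (simp add: vec_eq_iff forall_3 matrix_matrix_mult_def sum_3 det_3 trace_def
      principal_minors_def mat_def algebra_simps)

lemma elem_sym_3:
  "elem_sym 0 [a, b, c] = 1"
  "elem_sym 1 [a, b, c] = a + b + c"
  "elem_sym 2 [a, b, c] = a * b + a * c + b * c"
  "elem_sym 3 [a, b, c] = a * b * c"
proof -
  have 1: "{..<length [a,b,c]} = {0,1,2}" by auto
  \<comment> \<open>A conditional sum over the full power set lets \<open>Pow_insert\<close>
    enumerate the eight subsets.\<close>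
  have 2: "elem_sym k [a,b,c] = (\<Sum>J\<in>Pow {0,1,2}. if card J = k then \<Prod>j\<in>J. [a,b,c] ! j else 0)" for k
    unfolding elem_sym_def 1 by (subst sum.inter_filter[symmetric]) auto
  show "elem_sym 0 [a, b, c] = 1"
  "elem_sym 1 [a, b, c] = a + b + c"
  "elem_sym 2 [a, b, c] = a * b + a * c + b * c"
  "elem_sym 3 [a, b, c] = a * b * c"
    unfolding 2 by (simp_all add: Pow_insert insert_eq_iff doubleton_eq_iff algebra_simps)
qed

section \<open>Real roots of the characteristic polynomial and Vieta's formulas\<close>

lemma cubic_real_root:
  fixes b c d :: real
  obtains r q0 q1 where "[:d, c, b, 1:] = [:-r, 1:] * [:q0, q1, 1:]"
proof -
  define p where "p = [:d, c, b, 1:]"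
  \<comment> \<open>Reflecting \<open>p\<close> and changing the sign gives a monic cubic again, so
    one growth lemma controls the sign of \<open>p\<close> at both ends.\<close>
  define p' where "p' = [:- d, c, - b, 1:]"
  have p': "poly p (- x) = - poly p' x" for x
    by (simp add: p_def p'_def algebra_simps)
  have "lead_coeff p = 1" "lead_coeff p' = 1" by (simp_all add: p_def p'_def)
  then obtain m n where m: "\<And>x. m \<le> x \<Longrightarrow> 1 \<le> poly p x" and n: "\<And>x. n \<le> x \<Longrightarrow> 1 \<le> poly p' x"
    using poly_pinfty_gt_lc[of p] poly_pinfty_gt_lc[of p'] by (metis zero_less_one)
  define M where "M = \<bar>m\<bar> + \<bar>n\<bar> + 1"
  have M: "m \<le> M" "n \<le> M" "- M < M" by (auto simp: M_def)
  from m[OF M(1)] n[OF M(2)] have "poly p (- M) < 0" "0 < poly p M"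
    unfolding p' by linarith+
  then obtain r where "poly p r = 0"
    using poly_IVT_pos[OF M(3)] by blast
  \<comment> \<open>Synthetic division by the factor with root \<open>r\<close>: the vanishing
    remainder determines \<open>d\<close>.\<close>
  then have "d = - r * (c + r * (b + r))" by (simp add: p_def algebra_simps)
  then have "[:d, c, b, 1:] = [:-r, 1:] * [:c + r * (b + r), b + r, 1:]"
    by (simp add: algebra_simps)
  then show thesis by (rule that)
qed

lemma symmetric_bilinear:
  fixes A :: "real^'n^'n"
  assumes "transpose A = A"
  shows "v \<bullet> (A *v w) = (A *v v) \<bullet> w"
  by (metis assms dot_lmul_matrix vector_transpose_matrix)

text \<open>
  A real root \<open>r\<close> leaves a monic quadratic factor. If that had no real root, its value \<open>N\<close> at \<open>S\<close> would
  be a square plus a positive multiple of the identity, hence invertible, and Cayley--Hamilton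
  in the form \<open>(S - r) N = 0\<close> would give \<open>S = r\<close>, whose characteristic polynomial splits.
\<close>

lemma charpoly_splits:
  fixes A S :: "real^3^3"
  assumes A: "transpose A = A" and pos: "\<And>v. v \<noteq> 0 \<Longrightarrow> 0 < v \<bullet> (A *v v)"
    and AS: "transpose (A ** S) = A ** S"
  obtains a b c where "charpoly S = [:-a, 1:] * [:-b, 1:] * [:-c, 1:]"
proof -
  obtain r q0 q1 where q: "charpoly S = [:-r, 1:] * [:q0, q1, 1:]"
    unfolding charpoly_3 by (rule cubic_real_root)
  then have coeffs: "det S = r * q0" "principal_minors S = q0 - r * q1" "trace S = r - q1"
    by (auto simp: charpoly_3)
  have "q1\<^sup>2 - 4 * q0 \<ge> 0"
  proof (rule ccontr)
    assume neg: "\<not> q1\<^sup>2 - 4 * q0 \<ge> 0"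
    define N where "N = S ** S + q1 *\<^sub>R S + q0 *\<^sub>R mat 1"
    have "v = 0" if "N *v v = 0" for v
    proof (rule ccontr)
      assume "v \<noteq> 0"
      \<comment> \<open>Completing the square: \<open>N\<close> is the square of
        \<open>S + q1/2\<close> plus \<open>q0 - q1^2/4\<close>, and \<open>w\<close> is the image
        of \<open>v\<close> under the squared factor.\<close>
      define w where "w = S *v v + (q1 / 2) *\<^sub>R v"
      \<comment> \<open>\<open>S\<close> is self-adjoint for the inner product given by
        \<open>A\<close>; this moves one factor of the square to the other side.\<close>
      have sym: "(S *v v) \<bullet> (A *v u) = v \<bullet> (A *v (S *v u))" for u
        using symmetric_bilinear[OF AS, of v u] symmetric_bilinear[OF A, of "S *v v" u]
        by (simp add: matrix_vector_mul_assoc)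
      have "N *v v = S *v (S *v v) + q1 *\<^sub>R (S *v v) + q0 *\<^sub>R v"
        by (simp add: N_def matrix_vector_mult_add_rdistrib matrix_vector_mul_assoc
            scaleR_matrix_vector_assoc[symmetric])
      then have "v \<bullet> (A *v (N *v v)) = w \<bullet> (A *v w) + (q0 - q1\<^sup>2 / 4) * (v \<bullet> (A *v v))"
        by (simp add: w_def matrix_vector_right_distrib inner_add_left inner_add_right sym
            matrix_vector_mult_scaleR algebra_simps power2_eq_square)
      moreover have "0 \<le> w \<bullet> (A *v w)" using pos[of w] by (cases "w = 0") auto
      moreover have "0 < (q0 - q1\<^sup>2 / 4) * (v \<bullet> (A *v v))"
        using pos[OF \<open>v \<noteq> 0\<close>] neg by (intro mult_pos_pos) auto
      ultimately show False using that by simp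
    qed
    then obtain N' where N': "N ** N' = mat 1"
      by (metis invertible_def invertible_left_inverse matrix_left_invertible_ker)
    have "S ** N = S ** S ** S + q1 *\<^sub>R (S ** S) + q0 *\<^sub>R S"
      by (simp add: N_def matrix_add_ldistrib matrix_scalar_ac scalar_matrix_assoc matrix_mul_assoc)
    then have "S ** N - r *\<^sub>R N = 0"
      using Cayley_Hamilton_3[of S] unfolding coeffs N_def
      by (simp add: scaleR_add_right scaleR_diff_left mult.commute algebra_simps)
    then have "S ** N ** N' = (r *\<^sub>R N) ** N'" by simp
    then have "S = r *\<^sub>R mat 1"
      by (simp add: N' scalar_matrix_assoc[symmetric] flip: matrix_mul_assoc)
    then have "trace S = 3 * r" "principal_minors S = 3 * r\<^sup>2"
      by (simp_all add: trace_def principal_minors_def sum_3 mat_def power2_eq_square)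
    \<comment> \<open>For scalar \<open>S\<close> the quadratic factor has the double root
      \<open>r\<close>, so its discriminant is zero, contrary to \<open>neg\<close>.\<close>
    with coeffs have q1: "q1 = - 2 * r" and "q0 = 3 * r\<^sup>2 + r * q1" by auto
    then have "q0 = r\<^sup>2" by (simp add: power2_eq_square)
    with neg q1 show False by (simp add: power2_eq_square)
  qed
  then obtain s where "s\<^sup>2 = q1\<^sup>2 - 4 * q0" by (metis real_sqrt_pow2)
  then have "[:q0, q1, 1:] = [:- ((s - q1) / 2), 1:] * [:- ((- s - q1) / 2), 1:]"
    by (simp add: field_simps power2_eq_square)
  with q show thesis using that by (metis mult.assoc)
qed

text \<open>Sorting may permute \<open>a\<close>, \<open>b\<close>, \<open>c\<close>, so only the
  multiset of \<open>xs\<close> is known. The product of linear factors over it is still the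
  characteristic polynomial, and coefficients can be compared.\<close>

lemma Vieta_3:
  assumes "charpoly (S :: real^3^3) = [:-a, 1:] * [:-b, 1:] * [:-c, 1:]"
  defines "xs \<equiv> sorted_list_of_multiset (proots (charpoly S))"
  shows "elem_sym 0 xs = 1" "elem_sym 1 xs = trace S"
    "elem_sym 2 xs = principal_minors S" "elem_sym 3 xs = det S"
proof -
  have *: "proots (charpoly S) = {#a, b, c#}"
    unfolding assms(1) by (subst proots_mult, simp, simp)+ simp
  then have mset: "mset xs = {#a, b, c#}" by (simp add: xs_def)
  then have "length xs = 3" by (simp flip: size_mset)
  then obtain u v w where xs: "xs = [u, v, w]"
    by (auto simp: numeral_3_eq_3 length_Suc_conv)
  have "prod_mset (image_mset (\<lambda>a. [:-a, 1:]) (mset xs)) = charpoly S"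
    unfolding mset assms(1) by (simp add: algebra_simps)
  moreover have "[:-u, 1:] * [:-v, 1:] * [:-w, 1:]
      = [:- (u * v * w), u * v + u * w + v * w, - (u + v + w), 1:]"
    by (simp add: algebra_simps)
  ultimately have "[:- det S, principal_minors S, - trace S, 1:]
      = [:- (u * v * w), u * v + u * w + v * w, - (u + v + w), 1:]"
    by (simp only: xs charpoly_3) (simp add: algebra_simps)
  then have "trace S = u + v + w" "principal_minors S = u * v + u * w + v * w"
    "det S = u * v * w"
    by (simp_all only: pCons_eq_iff neg_equal_iff_equal)
  then show "elem_sym 0 xs = 1" "elem_sym 1 xs = trace S"
    "elem_sym 2 xs = principal_minors S" "elem_sym 3 xs = det S"
    unfolding xs elem_sym_3 by simp_all
qed

section \<open>Positive definiteness of \<open>form_I\<close> and symmetry of second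
  derivatives\<close>

text \<open>The quadratic form is the squared norm of the image of \<open>v\<close> under the
  differential, which is injective.\<close>

lemma form_I_pos_def:
  assumes d: "x differentiable (at p)" and i: "inj (frechet_derivative x (at p))"
    and v: "v \<noteq> 0"
  shows "0 < v \<bullet> (form_I x p *v v)"
proof -
  have "frechet_derivative x (at p) v \<noteq> 0"
    using linear_injective_0[OF linear_frechet_derivative[OF d]] i v by blast
  then show ?thesis unfolding inner_differential[OF d, symmetric] by simp
qed

lemma mvt_line:
  fixes f :: "'a::real_normed_vector \<Rightarrow> real"
  assumes t: "0 < t"
    and f: "\<And>s. s \<in> {0..t} \<Longrightarrow> (f has_derivative f' (q + s *\<^sub>R a)) (at (q + s *\<^sub>R a))"
  obtains s where "0 < s" "s < t" "f (q + t *\<^sub>R a) - f q = t * f' (q + s *\<^sub>R a) a"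
proof -
  have 1: "((\<lambda>s. f (q + s *\<^sub>R a)) has_derivative (\<lambda>h. f' (q + s *\<^sub>R a) (h *\<^sub>R a))) (at s within {0..t})"
    if "s \<in> {0..t}" for s
  proof -
    have "((\<lambda>s. q + s *\<^sub>R a) has_derivative (\<lambda>h. h *\<^sub>R a)) (at s within {0..t})"
      by (auto intro!: derivative_eq_intros)
    from has_derivative_compose[OF this f[OF that]] show ?thesis .
  qed
  obtain s where s: "s \<in> {0<..<t}"
    "f (q + t *\<^sub>R a) - f (q + 0 *\<^sub>R a) = f' (q + s *\<^sub>R a) ((t - 0) *\<^sub>R a)"
    using mvt_simple[OF t 1] by auto
  interpret linear "f' (q + s *\<^sub>R a)"
    using f[of s] s has_derivative_linear by auto
  show ?thesis using s by (intro that[of s]) (auto simp: scaleR)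
qed

text \<open>The second difference is the increment along \<open>a\<close> of \<open>q\<close> mapped
  to \<open>f (q + t b) - f q\<close>. One mean value step along \<open>a\<close> leaves an
  increment of \<open>f' q a\<close> along \<open>b\<close>, to which a second one applies.\<close>

lemma second_difference_mvt:
  fixes f :: "'a::real_normed_vector \<Rightarrow> real"
  assumes t: "0 < t"
    and f: "\<And>s r. s \<in> {0..t} \<Longrightarrow> r \<in> {0..t} \<Longrightarrow>
      (f has_derivative f' (p + s *\<^sub>R a + r *\<^sub>R b)) (at (p + s *\<^sub>R a + r *\<^sub>R b))"
    and f': "\<And>s r. s \<in> {0..t} \<Longrightarrow> r \<in> {0..t} \<Longrightarrow>
      ((\<lambda>q. f' q a) has_derivative f'' (p + s *\<^sub>R a + r *\<^sub>R b)) (at (p + s *\<^sub>R a + r *\<^sub>R b))"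
  obtains s r where "0 < s" "s < t" "0 < r" "r < t"
    "f (p + t *\<^sub>R a + t *\<^sub>R b) - f (p + t *\<^sub>R a) - f (p + t *\<^sub>R b) + f p
      = t * (t * f'' (p + s *\<^sub>R a + r *\<^sub>R b) b)"
proof -
  let ?g = "\<lambda>q. f (q + t *\<^sub>R b) - f q"
  have g: "(?g has_derivative (\<lambda>h. f' (p + s *\<^sub>R a + t *\<^sub>R b) h - f' (p + s *\<^sub>R a) h)) (at (p + s *\<^sub>R a))"
    if s: "s \<in> {0..t}" for s
  proof (rule has_derivative_diff)
    show "(f has_derivative f' (p + s *\<^sub>R a)) (at (p + s *\<^sub>R a))"
      using f[OF s, of 0] t by simp
    have "((\<lambda>q. q + t *\<^sub>R b) has_derivative (\<lambda>h. h)) (at (p + s *\<^sub>R a))"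
      by (intro has_derivative_add_const has_derivative_ident)
    then show "((\<lambda>q. f (q + t *\<^sub>R b)) has_derivative f' (p + s *\<^sub>R a + t *\<^sub>R b)) (at (p + s *\<^sub>R a))"
      by (rule has_derivative_compose) (use f[OF s, of t] t in simp)
  qed
  obtain s where s: "0 < s" "s < t"
    "?g (p + t *\<^sub>R a) - ?g p = t * (f' (p + s *\<^sub>R a + t *\<^sub>R b) a - f' (p + s *\<^sub>R a) a)"
    by (rule mvt_line[OF t, of ?g "\<lambda>y h. f' (y + t *\<^sub>R b) h - f' y h" p a, OF g])
  from s have "s \<in> {0..t}" by simp
  then obtain r where r: "0 < r" "r < t"
    "f' (p + s *\<^sub>R a + t *\<^sub>R b) a - f' (p + s *\<^sub>R a) a = t * f'' (p + s *\<^sub>R a + r *\<^sub>R b) b"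
    by (rule mvt_line[OF t, of "\<lambda>q. f' q a" f'' "p + s *\<^sub>R a" b, OF f'])
  show thesis
    by (rule that[OF s(1,2) r(1,2)]) (use s(3) r(3) in simp)
qed

lemma dist_parallelogram_less:
  fixes p a b :: "'a::real_normed_vector"
  assumes "0 < d"
  obtains D where "0 < D"
    "\<And>s r. 0 \<le> s \<Longrightarrow> s < D \<Longrightarrow> 0 \<le> r \<Longrightarrow> r < D \<Longrightarrow> dist (p + s *\<^sub>R a + r *\<^sub>R b) p < d"
proof -
  \<comment> \<open>The summand 1 keeps the denominator positive even for \<open>a = b = 0\<close>
    and makes the final estimate strict.\<close>
  define D where "D = d / (norm a + norm b + 1)"
  have "norm a + norm b + 1 > 0" by (intro add_nonneg_pos add_nonneg_nonneg) auto
  then have D: "D > 0" "D * (norm a + norm b + 1) = d" using assms by (auto simp: D_def)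
  have "dist (p + s *\<^sub>R a + r *\<^sub>R b) p < d" if "0 \<le> s" "s < D" "0 \<le> r" "r < D" for s r
  proof -
    have "dist (p + s *\<^sub>R a + r *\<^sub>R b) p = norm (s *\<^sub>R a + r *\<^sub>R b)"
      by (simp add: dist_norm add.assoc)
    also have "\<dots> \<le> s * norm a + r * norm b"
      using norm_triangle_ineq[of "s *\<^sub>R a" "r *\<^sub>R b"] that by simp
    also have "\<dots> \<le> D * norm a + D * norm b"
      using that by (intro add_mono mult_right_mono) auto
    also have "\<dots> < d" using D by (simp add: distrib_left)
    finally show ?thesis .
  qed
  with D(1) show thesis by (rule that)
qed

lemma continuous_on_open_ball:
  fixes g :: "'a::metric_space \<Rightarrow> 'b::metric_space"
  assumes "open U" "p \<in> U" "continuous_on U g" "0 < e"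
  obtains d where "0 < d" "\<And>y. dist y p < d \<Longrightarrow> y \<in> U" "\<And>y. dist y p < d \<Longrightarrow> dist (g y) (g p) < e"
proof -
  obtain d1 where d1: "d1 > 0" "\<And>y. dist y p < d1 \<Longrightarrow> y \<in> U"
    using assms(1,2) by (auto simp: open_dist)
  obtain d2 where d2: "d2 > 0" "\<And>y. y \<in> U \<Longrightarrow> dist y p < d2 \<Longrightarrow> dist (g y) (g p) < e"
    using assms(2-4) unfolding continuous_on_iff by force
  show thesis by (rule that[of "min d1 d2"]) (use d1 d2 in auto)
qed

text \<open>The quotient equals a value of \<open>f''\<close> inside a small parallelogram at
  \<open>p\<close>, so continuity brings it close to the value at \<open>p\<close>.\<close>

lemma second_difference_bound:
  fixes f :: "'a::real_normed_vector \<Rightarrow> real"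
  assumes U: "open U" "p \<in> U"
    and f: "\<And>q. q \<in> U \<Longrightarrow> (f has_derivative f' q) (at q)"
    and f': "\<And>q. q \<in> U \<Longrightarrow> ((\<lambda>q. f' q a) has_derivative f'' q) (at q)"
    and c: "continuous_on U (\<lambda>q. f'' q b)"
    and e: "0 < e"
  obtains D where "0 < D" "\<And>t. 0 < t \<Longrightarrow> t < D \<Longrightarrow>
    dist ((f (p + t *\<^sub>R a + t *\<^sub>R b) - f (p + t *\<^sub>R a) - f (p + t *\<^sub>R b) + f p) / t\<^sup>2) (f'' p b) < e"
proof -
  obtain d where d: "0 < d" "\<And>y. dist y p < d \<Longrightarrow> y \<in> U" "\<And>y. dist y p < d \<Longrightarrow> dist (f'' y b) (f'' p b) < e"
    by (rule continuous_on_open_ball[OF U c e]) blast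
  from d(1) obtain D where D: "0 < D" "\<And>s r. 0 \<le> s \<Longrightarrow> s < D \<Longrightarrow> 0 \<le> r \<Longrightarrow> r < D
      \<Longrightarrow> dist (p + s *\<^sub>R a + r *\<^sub>R b) p < d"
    by (rule dist_parallelogram_less) blast
  have "dist ((f (p + t *\<^sub>R a + t *\<^sub>R b) - f (p + t *\<^sub>R a) - f (p + t *\<^sub>R b) + f p) / t\<^sup>2) (f'' p b) < e"
    if t: "0 < t" "t < D" for t
  proof -
    have U': "p + s *\<^sub>R a + r *\<^sub>R b \<in> U" if "s \<in> {0..t}" "r \<in> {0..t}" for s r
      using that t D(2)[of s r] by (intro d(2)) auto
    obtain s r where sr: "0 < s" "s < t" "0 < r" "r < t"
      "f (p + t *\<^sub>R a + t *\<^sub>R b) - f (p + t *\<^sub>R a) - f (p + t *\<^sub>R b) + f p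
        = t * (t * f'' (p + s *\<^sub>R a + r *\<^sub>R b) b)"
      by (rule second_difference_mvt[OF t(1), of f f' p a b f'', OF f[OF U'] f'[OF U']])
    have "dist (f'' (p + s *\<^sub>R a + r *\<^sub>R b) b) (f'' p b) < e"
      using D(2)[of s r] sr t by (intro d(3)) auto
    with t show ?thesis unfolding sr(5) by (simp add: power2_eq_square)
  qed
  with D(1) show thesis by (rule that)
qed

lemma symmetric_second_derivative:
  fixes f :: "'a::real_normed_vector \<Rightarrow> 'b::real_inner"
  assumes U: "open U" "p \<in> U" and C2: "Ck_on 2 f U"
  shows "frechet_derivative (\<lambda>q. frechet_derivative f (at q) a) (at p) b
    = frechet_derivative (\<lambda>q. frechet_derivative f (at q) b) (at p) a"
proof -
  let ?D = "\<lambda>a q. frechet_derivative f (at q) a"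
  let ?D2 = "\<lambda>a b q. frechet_derivative (?D a) (at q) b"
  have C: "\<And>q. q \<in> U \<Longrightarrow> f differentiable (at q)"
    "\<And>q a. q \<in> U \<Longrightarrow> ?D a differentiable (at q)"
    "\<And>a b. continuous_on U (?D2 a b)"
    using C2 by (auto simp: numeral_2_eq_2)
  \<comment> \<open>The mean value argument is for real functions; pairing with an arbitrary
    \<open>c\<close> reduces to that case and still determines the vector.\<close>
  have "?D2 a b p \<bullet> c = ?D2 b a p \<bullet> c" for c
  proof -
    let ?\<Delta> = "\<lambda>a b t. (f (p + t *\<^sub>R a + t *\<^sub>R b) \<bullet> c - f (p + t *\<^sub>R a) \<bullet> c
      - f (p + t *\<^sub>R b) \<bullet> c + f p \<bullet> c) / t\<^sup>2"
    have bound: "\<exists>d>0. \<forall>t. 0 < t \<longrightarrow> t < d \<longrightarrow> dist (?\<Delta> a b t) (?D2 a b p \<bullet> c) < e" if "0 < e" for a b e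
    proof -
      have "((\<lambda>q. f q \<bullet> c) has_derivative (\<lambda>h. ?D h q \<bullet> c)) (at q)" if "q \<in> U" for q
        using C(1)[OF that] by (intro has_derivative_inner_left) (simp add: frechet_derivative_works)
      moreover have "((\<lambda>q. ?D a q \<bullet> c) has_derivative (\<lambda>h. ?D2 a h q \<bullet> c)) (at q)" if "q \<in> U" for q
        using C(2)[OF that] by (intro has_derivative_inner_left) (simp add: frechet_derivative_works)
      moreover have "continuous_on U (\<lambda>q. ?D2 a b q \<bullet> c)"
        by (intro continuous_intros C)
      ultimately show ?thesis
        by (rule second_difference_bound[OF U, where f = "\<lambda>q. f q \<bullet> c"
              and f' = "\<lambda>q h. ?D h q \<bullet> c" and f'' = "\<lambda>q h. ?D2 a h q \<bullet> c", OF _ _ _ that]) blast+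
    qed
    have "dist (?D2 a b p \<bullet> c) (?D2 b a p \<bullet> c) \<le> 0 + e" if "0 < e" for e
    proof -
      from that have "0 < e / 2" by simp
      then obtain d1 d2 where "0 < d1" "0 < d2"
        and d: "\<And>t. 0 < t \<Longrightarrow> t < d1 \<Longrightarrow> dist (?\<Delta> a b t) (?D2 a b p \<bullet> c) < e / 2"
          "\<And>t. 0 < t \<Longrightarrow> t < d2 \<Longrightarrow> dist (?\<Delta> b a t) (?D2 b a p \<bullet> c) < e / 2"
        using bound[of "e / 2" a b] bound[of "e / 2" b a] by blast
      define t where "t = min d1 d2 / 2"
      have t: "0 < t" "t < d1" "t < d2" using \<open>0 < d1\<close> \<open>0 < d2\<close> by (auto simp: t_def)
      \<comment> \<open>Swapping \<open>a\<close> and \<open>b\<close> only exchanges the two middle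
        terms of the second difference.\<close>
      have "?\<Delta> a b t = ?\<Delta> b a t" by (simp add: algebra_simps)
      then have "dist (?\<Delta> a b t) (?D2 b a p \<bullet> c) < e / 2"
        using d(2)[OF t(1,3)] by (simp only:)
      with d(1)[OF t(1,2)] have "dist (?D2 a b p \<bullet> c) (?D2 b a p \<bullet> c) < e"
        by (rule dist_triangle_half_r)
      then show ?thesis by simp
    qed
    then have "dist (?D2 a b p \<bullet> c) (?D2 b a p \<bullet> c) \<le> 0" by (rule field_le_epsilon)
    then show ?thesis by simp
  qed
  then show ?thesis by (metis vector_eq_rdot)
qed

section \<open>The identity between the fundamental forms\<close>

theorem corollary1:
  fixes x G :: "real^3 \<Rightarrow> real^4" and U :: "(real^3) set" and p :: "real^3"
  assumes "open U" and "smooth_on x U" and "immersion_on x U" and "unit_normal_on x G U"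
    and "p \<in> U"
  shows "curvature x G 0 p *\<^sub>R form_IV x G p - (3 * curvature x G 1 p) *\<^sub>R form_III x G p
    + (3 * curvature x G 2 p) *\<^sub>R form_II x G p - curvature x G 3 p *\<^sub>R form_I x p = 0"
proof -
  define A where "A = form_I x p"
  define S where "S = shape_matrix x G p"
  have "Ck_on 2 x U" "Ck_on 1 x U" using assms(2) by (simp_all only: smooth_on_def)
  then have d: "x differentiable (at p)" using assms(5) by simp
  have i: "inj (frechet_derivative x (at p))" using assms by (simp add: immersion_on_def)
  \<comment> \<open>\<open>matrix_inv\<close> is a choice, so its inverse property rests on the
    invertibility of \<open>form_I\<close>, which the immersion provides.\<close>
  have "A ** matrix_inv A = mat 1"
    using someI_ex[OF invertible_form_I[OF d i, unfolded invertible_def]]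
    by (simp add: matrix_inv_def A_def)
  then have AS: "form_II x G p = A ** S"
    by (simp add: S_def shape_matrix_def A_def matrix_mul_assoc)
  have "0 < v \<bullet> (A *v v)" if "v \<noteq> 0" for v
    unfolding A_def by (rule form_I_pos_def[OF d i that])
  moreover have "transpose A = A"
    by (simp add: A_def form_I_def transpose_def inner_commute)
  \<comment> \<open>\<open>A ** S\<close> is \<open>form_II\<close>, whose entries are normal
    components of mixed second derivatives along the axes.\<close>
  moreover have "transpose (A ** S) = A ** S"
    using symmetric_second_derivative[OF assms(1,5) \<open>Ck_on 2 x U\<close>]
    unfolding AS[symmetric] by (simp add: form_II_def transpose_def partial_def[abs_def])
  ultimately obtain a b c where "charpoly S = [:-a, 1:] * [:-b, 1:] * [:-c, 1:]"
    using charpoly_splits by metis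
  note Vieta = Vieta_3[OF this]
  \<comment> \<open>The binomials are 1, 3, 3, 1, so the factors 3 cancel the normalisation of the
    two middle curvatures.\<close>
  have curv: "curvature x G 0 p = 1" "3 * curvature x G 1 p = trace S"
    "3 * curvature x G 2 p = principal_minors S" "curvature x G 3 p = det S"
    using Vieta
    by (simp_all add: curvature_def principal_curvatures_def S_def numeral_eq_Suc)
  have "A ** (P - Q) = A ** P - A ** Q" for P Q :: "real^3^3"
    by (simp add: matrix_matrix_mult_def vec_eq_iff right_diff_distrib sum_subtractf)
  \<comment> \<open>The forms are \<open>A\<close> times successive powers of \<open>S\<close>, so
    \<open>A\<close> factors out on the left.\<close>
  then have "form_IV x G p - trace S *\<^sub>R form_III x G p + principal_minors S *\<^sub>R form_II x G p
      - det S *\<^sub>R form_I x p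
    = A ** (S ** S ** S - trace S *\<^sub>R (S ** S) + principal_minors S *\<^sub>R S - det S *\<^sub>R mat 1)"
    by (simp add: form_IV_def form_III_def AS A_def[symmetric] S_def[symmetric]
      matrix_add_ldistrib matrix_scalar_ac scalar_matrix_assoc matrix_mul_assoc)
  then show ?thesis unfolding curv Cayley_Hamilton_3 by simp
qed

end
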